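(* Let $T_L$ be a stalactic tableau. Let $a_1,\dots,a_k$ be the labels of the simple columns in $T_L$, ordered from left to right. For $1 \leq i \leq k$, let $m_i$ be the number of columns of $T_L$ to the right of and including the column labelled $a_i$. Then there are $$\frac{|\mathrm{supp}(T_L)|!}{m_1\cdots m_k}$$ distinct stalactic tableaux $T_R$ such that $(T_L,T_R)$ is a pair of twin stalactic tableaux.
   Context: A stalactic tableau is a top-aligned finite sequence of nonempty columns of cells, labelled by $\mathbb{N}=\{1,2,\dots\}$, such that all cells in a column have the same label and distinct columns have distinct labels. For a stalactic tableau $T$: $\mathrm{supp}(T)$ is its set of column labels; $\mathrm{cont}(T)$ records for each letter the number of cells labelled by it; $\rho_T(c)$ is the position from the left of the column labelled $c$; a column is simple if it has exactly one cell. A pair $(T_L,T_R)$ of stalactic tableaux is a pair of twin stalactic tableaux if $\mathrm{cont}(T_L)=\mathrm{cont}(T_R)$ and, for each simple column labelled $c$ and any other column labelled $d$, $\rho_{T_L}(c)<\rho_{T_L}(d)$ implies $\rho_{T_R}(c)<\rho_{T_R}(d)$. *)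

theory Defs
  imports Complex_Main
begin

text \<open>A tableau is the list of its columns from left to right; a column is the list of the labels
  of its cells from top to bottom. Top alignment is implicit in this encoding. Letters are the
  positive natural numbers, so \<^term>\<open>0::nat\<close> is excluded as a label. The empty sequence
  of columns is a stalactic tableau.\<close>

type_synonym tableau = "nat list list"

text \<open>Meaningful only for nonempty columns with all labels equal.\<close>

definition col_label :: "nat list \<Rightarrow> nat" where
  "col_label C = hd C"

definition stalactic :: "tableau \<Rightarrow> bool" where
  "stalactic T \<longleftrightarrow>
     (\<forall>C\<in>set T. C \<noteq> []) \<and>
     (\<forall>C\<in>set T. \<forall>x\<in>set C. 1 \<le> x) \<and>
     (\<forall>C\<in>set T. \<forall>x\<in>set C. \<forall>y\<in>set C. x = y) \<and>
     (\<forall>i<length T. \<forall>j<length T. i \<noteq> j \<longrightarrow> col_label (T ! i) \<noteq> col_label (T ! j))"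

definition supp :: "tableau \<Rightarrow> nat set" where
  "supp T = col_label ` set T"

definition cont :: "tableau \<Rightarrow> nat \<Rightarrow> nat" where
  "cont T x = count_list (concat T) x"

text \<open>Positions are counted from 1. The description is unique if \<^term>\<open>T\<close> is stalactic and
  \<^term>\<open>c \<in> supp T\<close>, and is unspecified if \<^term>\<open>c \<notin> supp T\<close>.\<close>

definition rho :: "tableau \<Rightarrow> nat \<Rightarrow> nat" where
  "rho T c = (THE p. 1 \<le> p \<and> p \<le> length T \<and> col_label (T ! (p - 1)) = c)"

definition simple :: "nat list \<Rightarrow> bool" where
  "simple C \<longleftrightarrow> length C = 1"

definition simple_labels :: "tableau \<Rightarrow> nat list" where
  "simple_labels T = map col_label (filter simple T)"

text \<open>Simplicity of the column labelled \<^term>\<open>c\<close> may be read off from either tableau, since the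
  contents agree.\<close>

definition twin_stalactic :: "tableau \<Rightarrow> tableau \<Rightarrow> bool" where
  "twin_stalactic TL TR \<longleftrightarrow>
     stalactic TL \<and> stalactic TR \<and> cont TL = cont TR \<and>
     (\<forall>c\<in>set (simple_labels TL). \<forall>d\<in>supp TL. d \<noteq> c \<longrightarrow>
        rho TL c < rho TL d \<longrightarrow> rho TR c < rho TR d)"

definition cols_from :: "tableau \<Rightarrow> nat \<Rightarrow> nat" where
  "cols_from T c = card {p. rho T c \<le> p \<and> p \<le> length T}"

end

theory Submission
  imports Defs
begin

text \<open>
  A stalactic tableau is determined by its content and its word of labels, so the tableaux twin to
  \<open>TL\<close> correspond to the rearrangements of the label word of \<open>TL\<close> in which every simple letter stays
  in front of the letters that it precedes in \<open>TL\<close>. Build the word of \<open>TL\<close> from right to left,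
  prepending a letter \<open>x\<close> to a word of length \<open>n\<close>. No letter has to stay in front of \<open>x\<close>. If \<open>x\<close> is
  simple, it has to come first; otherwise it may be inserted at any of \<open>n + 1\<close> places. So
  the count is the factorial with the factors of the simple letters left out.
\<close>

section \<open>Words under precedence constraints, and their number\<close>

primrec precedes :: "'a \<Rightarrow> 'a \<Rightarrow> 'a list \<Rightarrow> bool" where
  "precedes c d [] \<longleftrightarrow> False"
| "precedes c d (y # ys) \<longleftrightarrow> c = y \<and> d \<in> set ys \<or> precedes c d ys"

text \<open>\<open>S\<close> marks the letters whose precedences are binding; later it selects the
  labels with content 1. For words without repetition, equal letter sets already make
  \<open>ys\<close> a permutation of \<open>xs\<close>.\<close>

definition rearrangements :: "('a \<Rightarrow> bool) \<Rightarrow> 'a list \<Rightarrow> 'a list set" where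
  "rearrangements S xs =
     {ys. distinct ys \<and> set ys = set xs \<and>
          (\<forall>c d. S c \<longrightarrow> precedes c d xs \<longrightarrow> precedes c d ys)}"

lemma precedes_append:
  "precedes c d (us @ vs) \<longleftrightarrow>
     precedes c d us \<or> precedes c d vs \<or> c \<in> set us \<and> d \<in> set vs"
  by (induction us) auto

lemma precedes_set: "precedes c d ys \<Longrightarrow> c \<in> set ys \<and> d \<in> set ys"
  by (induction ys) auto

lemma precedes_nth_iff:
  assumes "distinct ys" "i < length ys" "j < length ys"
  shows "precedes (ys ! i) (ys ! j) ys \<longleftrightarrow> i < j"
  using assms
proof (induction ys arbitrary: i j)
  case (Cons y ys)
  then show ?case
    by (cases i; cases j) (auto dest: precedes_set)
qed simp

text \<open>As the head, \<open>x\<close> precedes every other letter, and \<open>S x\<close> makes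
  all of these precedences binding; so \<open>x\<close> stays at the front and only the tail can
  vary.\<close>

lemma rearrangements_Cons_constrained:
  assumes "S x" "distinct (x # xs)"
  shows "rearrangements S (x # xs) = (#) x ` rearrangements S xs"
proof (intro subset_antisym subsetI)
  fix ys assume ys: "ys \<in> rearrangements S (x # xs)"
  then obtain y zs where yz: "ys = y # zs"
    by (cases ys) (auto simp: rearrangements_def)
  \<comment> \<open>Otherwise \<open>x\<close> would have to precede \<open>y\<close>, which puts a
    second \<open>y\<close> into \<open>zs\<close> and contradicts distinctness.\<close>
  have "y = x"
  proof (rule ccontr)
    assume "y \<noteq> x"
    with ys yz have "y \<in> set xs" "x \<in> set zs" by (auto simp: rearrangements_def)
    with ys assms(1) have "precedes x y ys"
      by (auto simp: rearrangements_def)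
    with ys yz \<open>y \<noteq> x\<close> show False
      by (auto simp: rearrangements_def dest: precedes_set)
  qed
  have "zs \<in> rearrangements S xs"
  proof -
    have "precedes c d zs" if "S c" "precedes c d xs" for c d
    proof -
      have "c \<noteq> x" using that assms(2) by (auto dest: precedes_set)
      with that ys yz \<open>y = x\<close> show ?thesis
        by (auto simp: rearrangements_def)
    qed
    moreover have "distinct zs" "set zs = set xs"
      using ys yz \<open>y = x\<close> assms(2) insert_ident[of x "set zs" "set xs"]
      by (simp_all add: rearrangements_def)
    ultimately show ?thesis by (simp add: rearrangements_def)
  qed
  with yz \<open>y = x\<close> show "ys \<in> (#) x ` rearrangements S xs" by blast
next
  fix ys assume "ys \<in> (#) x ` rearrangements S xs"
  with assms show "ys \<in> rearrangements S (x # xs)"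
    by (auto simp: rearrangements_def)
qed

text \<open>No binding constraint mentions \<open>x\<close>: those with \<open>x\<close> first are
  not binding, and no letter precedes the head. So \<open>x\<close> may be inserted at any index
  \<open>i\<close>, and deleting it is the inverse.\<close>

lemma bij_betw_rearrangements_Cons_free:
  assumes "\<not> S x" "distinct (x # xs)"
  shows "bij_betw (\<lambda>(i, ys). take i ys @ x # drop i ys)
           ({..length xs} \<times> rearrangements S xs) (rearrangements S (x # xs))"
proof -
  have len: "length ys = length xs" if "ys \<in> rearrangements S xs" for ys
    using that assms distinct_card[of ys] distinct_card[of xs] by (simp add: rearrangements_def)
  have inj: "i = j \<and> ys = zs"
    if ys: "ys \<in> rearrangements S xs" "i \<le> length xs"
      and zs: "zs \<in> rearrangements S xs" "j \<le> length xs"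
      and eq: "take i ys @ x # drop i ys = take j zs @ x # drop j zs" for i j ys zs
  proof -
    have "x \<notin> set ys" "x \<notin> set zs" using ys zs assms by (auto simp: rearrangements_def)
    then have "x \<notin> set (take i ys)" "x \<notin> set (take j zs)"
      "x \<notin> set (drop i ys)" "x \<notin> set (drop j zs)"
      by (auto dest: in_set_takeD in_set_dropD)
    \<comment> \<open>\<open>x\<close> occurs exactly once in the common word, so the parts before
      and after it are determined.\<close>
    with eq have t: "take i ys = take j zs" and d: "drop i ys = drop j zs"
      by (auto simp: append_eq_append_conv2 append_eq_Cons_conv Cons_eq_append_conv)
    have "ys = zs" using t d by (metis append_take_drop_id)
    moreover have "i = j" using arg_cong[OF t, of length] len ys zs by simp
    ultimately show ?thesis by simp
  qed
  have into: "take i ys @ x # drop i ys \<in> rearrangements S (x # xs)"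
    if ys: "ys \<in> rearrangements S xs" for i ys
  proof -
    \<comment> \<open>Inserting a letter destroys no existing precedence; only the constraints
      inherited from \<open>xs\<close> have to be checked.\<close>
    have sub: "precedes c d (take i ys @ x # drop i ys)" if "precedes c d (take i ys @ drop i ys)" for c d
      using that unfolding precedes_append by auto
    have "distinct (take i ys @ drop i ys)" "set (take i ys @ drop i ys) = set xs"
      using ys by (auto simp: rearrangements_def)
    then have "distinct (take i ys @ x # drop i ys)" "set (take i ys @ x # drop i ys) = set (x # xs)"
      using assms(2) by (auto simp del: append_take_drop_id)
    moreover have "precedes c d (take i ys @ x # drop i ys)"
      if "S c" "precedes c d (x # xs)" for c d
      using that ys assms(1) by (intro sub) (auto simp: rearrangements_def)
    ultimately show ?thesis unfolding rearrangements_def by blast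
  qed
  have onto: "\<exists>i ys. i \<le> length xs \<and> ys \<in> rearrangements S xs \<and> zs = take i ys @ x # drop i ys"
    if zs: "zs \<in> rearrangements S (x # xs)" for zs
  proof -
    have "x \<in> set zs" using zs by (auto simp: rearrangements_def)
    then obtain us vs where uv: "zs = us @ x # vs" by (meson split_list)
    have "precedes c d (us @ vs)" if "S c" "precedes c d xs" for c d
    proof -
      have "c \<noteq> x" "d \<noteq> x" using that assms by (auto dest: precedes_set)
      moreover have "precedes c d zs" using zs that
        by (auto simp: rearrangements_def)
      ultimately show ?thesis by (auto simp: uv precedes_append)
    qed
    moreover have "distinct (us @ vs)" "set (us @ vs) = set xs"
      using zs uv assms(2) insert_ident[of x "set (us @ vs)" "set xs"]
      by (simp_all add: rearrangements_def)
    ultimately have r: "us @ vs \<in> rearrangements S xs"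
      by (simp add: rearrangements_def)
    have "length us \<le> length xs" using len[OF r] by simp
    with r uv show ?thesis by (intro exI[of _ "length us"] exI[of _ "us @ vs"]) auto
  qed
  show ?thesis
    unfolding bij_betw_def
  proof
    show "inj_on (\<lambda>(i, ys). take i ys @ x # drop i ys) ({..length xs} \<times> rearrangements S xs)"
      by (rule inj_onI) (use inj in auto)
    show "(\<lambda>(i, ys). take i ys @ x # drop i ys) ` ({..length xs} \<times> rearrangements S xs) =
            rearrangements S (x # xs)"
      using into onto by (fastforce simp: image_iff)
  qed
qed

lemma finite_rearrangements: "finite (rearrangements S xs)"
proof -
  have "rearrangements S xs \<subseteq> {ys. set ys \<subseteq> set xs \<and> distinct ys}"
    by (auto simp: rearrangements_def)
  then show ?thesis by (rule finite_subset) (simp add: finite_subset_distinct)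
qed

text \<open>Each factor is the length of the suffix starting at a constrained letter. Prepending a
  letter multiplies the factorial by \<open>Suc (length xs)\<close>; a constrained letter brings
  this factor into the product, a free one into the cardinality.\<close>

lemma card_rearrangements:
  assumes "distinct xs"
  shows "card (rearrangements S xs) *
           prod_list (map (\<lambda>c. length (dropWhile (\<lambda>y. y \<noteq> c) xs)) (filter S xs)) =
         fact (length xs)"
  using assms
proof (induction xs)
  case Nil
  have "rearrangements S [] = {[]}" by (auto simp: rearrangements_def)
  then show ?case by simp
next
  case (Cons x xs)
  let ?m = "\<lambda>xs c. length (dropWhile (\<lambda>y. y \<noteq> c) xs)"
  \<comment> \<open>The letters of \<open>xs\<close> differ from \<open>x\<close>, so
    \<open>dropWhile\<close> discards the new head and the old suffix lengths persist.\<close>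
  have m: "map (?m (x # xs)) (filter S xs) = map (?m xs) (filter S xs)"
    using Cons.prems by auto
  have mx: "?m (x # xs) x = Suc (length xs)" by simp
  have IH: "card (rearrangements S xs) * prod_list (map (?m xs) (filter S xs)) =
      fact (length xs)"
    using Cons by simp
  show ?case
  proof (cases "S x")
    case True
    have "card (rearrangements S (x # xs)) = card (rearrangements S xs)"
      using rearrangements_Cons_constrained[of S, OF True Cons.prems] by (simp add: card_image)
    moreover have "prod_list (map (?m (x # xs)) (filter S (x # xs))) =
        Suc (length xs) * prod_list (map (?m xs) (filter S xs))"
      using True by (simp only: filter.simps list.map prod_list.Cons m mx if_True)
    ultimately show ?thesis using IH by (simp add: algebra_simps)
  next
    case False
    have "card (rearrangements S (x # xs)) = Suc (length xs) * card (rearrangements S xs)"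
      using bij_betw_same_card[OF bij_betw_rearrangements_Cons_free[of S, OF False Cons.prems]]
      by (simp add: card_cartesian_product)
    moreover have "prod_list (map (?m (x # xs)) (filter S (x # xs))) =
        prod_list (map (?m xs) (filter S xs))"
      using False by (simp only: filter.simps m if_False)
    ultimately show ?thesis using IH by (simp add: algebra_simps)
  qed
qed

section \<open>Tableaux recovered from content and label word\<close>

definition tableau_of :: "(nat \<Rightarrow> nat) \<Rightarrow> nat list \<Rightarrow> tableau" where
  "tableau_of f ys = map (\<lambda>c. replicate (f c) c) ys"

lemma stalactic_iff_distinct_labels:
  "stalactic T \<longleftrightarrow>
     (\<forall>C\<in>set T. C \<noteq> [] \<and> (\<forall>x\<in>set C. 1 \<le> x \<and> (\<forall>y\<in>set C. x = y))) \<and>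
     distinct (map col_label T)"
  unfolding stalactic_def distinct_conv_nth by auto

text \<open>Positive multiplicities keep the columns nonempty; the label of an empty column would be
  an unspecified \<open>hd []\<close>.\<close>

lemma map_col_label_tableau_of:
  "\<forall>c\<in>set ys. 0 < f c \<Longrightarrow> map col_label (tableau_of f ys) = ys"
  by (induction ys) (auto simp: tableau_of_def col_label_def)

lemma stalactic_tableau_of:
  assumes "distinct ys" "\<forall>c\<in>set ys. 0 < f c \<and> 1 \<le> c"
  shows "stalactic (tableau_of f ys)"
  using assms map_col_label_tableau_of[of ys f]
  by (auto simp: stalactic_iff_distinct_labels tableau_of_def)

lemma cont_tableau_of:
  "distinct ys \<Longrightarrow> cont (tableau_of f ys) x = (if x \<in> set ys then f x else 0)"
proof (induction ys)
  case (Cons y ys)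
  have "count_list (replicate n y) x = (if x = y then n else 0)" for n
    by (induction n) auto
  with Cons show ?case by (auto simp: cont_def tableau_of_def)
qed (simp add: cont_def tableau_of_def)

text \<open>Labels are distinct and columns constant, so no other column contributes to the count of
  this label.\<close>

lemma cont_col_label:
  assumes "stalactic T" "C \<in> set T"
  shows "cont T (col_label C) = length C"
proof -
  obtain us vs where T: "T = us @ C # vs" using assms(2) by (meson split_list)
  have label: "x = col_label D" if "D \<in> set T" "x \<in> set D" for D x
    using assms(1) that unfolding stalactic_iff_distinct_labels col_label_def
    by (metis hd_in_set)
  have "x \<noteq> col_label C" if "D \<in> set us \<union> set vs" "x \<in> set D" for D x
  proof -
    have "col_label C \<notin> col_label ` (set us \<union> set vs)"
      using assms(1) unfolding stalactic_iff_distinct_labels T by (simp add: image_Un)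
    moreover have "x = col_label D" using label[of D x] that T by auto
    ultimately show ?thesis using that(1) by (metis imageI)
  qed
  then have "col_label C \<notin> set (concat us)" "col_label C \<notin> set (concat vs)"
    unfolding set_concat by blast+
  moreover have "C = replicate (length C) (col_label C)"
    using label[OF assms(2)] by (intro replicate_eqI) auto
  moreover have "count_list (replicate n y) y = n" for n :: nat and y :: nat
    by (induction n) auto
  ultimately show ?thesis by (metis T add_0 add_0_right concat.simps(2) concat_append cont_def
        count_list_0_iff count_list_append)
qed

lemma cont_pos_iff:
  assumes "stalactic T"
  shows "0 < cont T c \<longleftrightarrow> c \<in> supp T"
proof
  assume "0 < cont T c"
  then obtain C where C: "C \<in> set T" "c \<in> set C"
    by (auto simp: cont_def) (metis UN_E count_notin less_irrefl set_concat)
  with assms have "c = col_label C"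
    unfolding stalactic_def col_label_def by (metis hd_in_set)
  with C show "c \<in> supp T" by (auto simp: supp_def)
next
  assume "c \<in> supp T"
  with assms cont_col_label show "0 < cont T c" by (auto simp: supp_def stalactic_def)
qed

lemma supp_pos: "stalactic T \<Longrightarrow> c \<in> supp T \<Longrightarrow> 1 \<le> c"
  unfolding stalactic_def supp_def col_label_def by force

lemma supp_conv_set: "supp T = set (map col_label T)"
  by (simp add: supp_def)

text \<open>A column is its label repeated as often as the content says, so content and label word
  determine the tableau.\<close>

lemma tableau_of_cont:
  assumes "stalactic T"
  shows "tableau_of (cont T) (map col_label T) = T"
proof -
  have "replicate (cont T (col_label C)) (col_label C) = C" if C: "C \<in> set T" for C
  proof -
    have "x = col_label C" if "x \<in> set C" for x
      using assms C that unfolding stalactic_def col_label_def by (metis hd_in_set)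
    then show ?thesis using cont_col_label[OF assms C] by (metis replicate_eqI)
  qed
  then show ?thesis by (simp add: tableau_of_def map_idI)
qed

section \<open>Simple labels, positions and column counts in terms of the label word\<close>

lemma simple_labels_conv_filter:
  assumes "stalactic T"
  shows "simple_labels T = filter (\<lambda>c. cont T c = 1) (map col_label T)"
  using cont_col_label[OF assms]
  by (auto simp: simple_labels_def filter_map simple_def intro!: filter_cong arg_cong[of _ _ "map _"])

lemma rho_col_label:
  assumes "stalactic T" "i < length T"
  shows "rho T (col_label (T ! i)) = Suc i"
  unfolding rho_def
proof (rule the_equality)
  fix p assume p: "1 \<le> p \<and> p \<le> length T \<and> col_label (T ! (p - 1)) = col_label (T ! i)"
  then have "p - 1 < length T" by linarith
  with assms p have "p - 1 = i" unfolding stalactic_def by blast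
  with p show "p = Suc i" by linarith
qed (use assms in simp)

lemma rho_less_iff_precedes:
  assumes "stalactic T" "c \<in> supp T" "d \<in> supp T"
  shows "rho T c < rho T d \<longleftrightarrow> precedes c d (map col_label T)"
proof -
  obtain i j where ij: "i < length T" "j < length T" "c = col_label (T ! i)" "d = col_label (T ! j)"
    using assms(2,3) by (auto simp: supp_def in_set_conv_nth)
  have "distinct (map col_label T)" using assms(1) by (simp add: stalactic_iff_distinct_labels)
  from precedes_nth_iff[OF this, of i j] show ?thesis
    using ij rho_col_label[OF assms(1)] by simp
qed

text \<open>Split \<open>T\<close> at the column labelled \<open>c\<close>: both sides count this
  column and the columns \<open>vs\<close> to its right.\<close>

lemma cols_from_conv_dropWhile:
  assumes "stalactic T" "c \<in> supp T"
  shows "cols_from T c = length (dropWhile (\<lambda>y. y \<noteq> c) (map col_label T))"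
proof -
  obtain C where C: "C \<in> set T" "c = col_label C" using assms(2) by (auto simp: supp_def)
  then obtain us vs where T: "T = us @ C # vs" by (meson split_list)
  have "c \<notin> set (map col_label us)"
    using assms(1) C by (auto simp: stalactic_iff_distinct_labels T)
  then have "length (dropWhile (\<lambda>y. y \<noteq> c) (map col_label T)) = Suc (length vs)"
    using C(2) by (subst T, simp, subst dropWhile_append2) (auto simp: image_iff)
  moreover have "rho T c = Suc (length us)"
    using rho_col_label[OF assms(1), of "length us"] C(2) by (simp add: T)
  moreover have "{p. Suc (length us) \<le> p \<and> p \<le> length T} = {Suc (length us)..length T}"
    by auto
  ultimately show ?thesis by (simp add: cols_from_def T)
qed

section \<open>Twin tableaux as constrained rearrangements\<close>

lemma twin_stalactic_iff:
  assumes "stalactic TL"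
  shows "twin_stalactic TL TR \<longleftrightarrow>
     stalactic TR \<and> cont TL = cont TR \<and>
     map col_label TR \<in> rearrangements (\<lambda>c. cont TL c = 1) (map col_label TL)"
proof (cases "stalactic TR \<and> cont TL = cont TR")
  case True
  then have supp: "supp TR = supp TL" using cont_pos_iff assms by (metis subsetI subset_antisym)
  have dist: "distinct (map col_label TR)" "distinct (map col_label TL)"
    using assms True by (simp_all add: stalactic_iff_distinct_labels)
  \<comment> \<open>With this, the condition \<open>d \<noteq> c\<close> in the twin relation
    follows from the precedence itself.\<close>
  have not_refl: "\<not> precedes c c (map col_label TL)" for c
    using precedes_nth_iff[OF dist(2)] precedes_set
    by (metis in_set_conv_nth less_irrefl)
  have simple: "c \<in> set (simple_labels TL) \<longleftrightarrow> c \<in> supp TL \<and> cont TL c = 1" for c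
    using simple_labels_conv_filter[OF assms] by (auto simp: supp_def)
  have "twin_stalactic TL TR \<longleftrightarrow>
      (\<forall>c\<in>set (simple_labels TL). \<forall>d\<in>supp TL. d \<noteq> c \<longrightarrow>
        precedes c d (map col_label TL) \<longrightarrow> precedes c d (map col_label TR))"
    using assms True supp simple rho_less_iff_precedes
    unfolding twin_stalactic_def by (metis (no_types, lifting))
  also have "\<dots> \<longleftrightarrow>
      (\<forall>c d. cont TL c = 1 \<longrightarrow>
        precedes c d (map col_label TL) \<longrightarrow> precedes c d (map col_label TR))"
    using not_refl simple precedes_set[of _ _ "map col_label TL"]
    unfolding supp_conv_set by metis
  finally show ?thesis
    using True dist supp by (auto simp: rearrangements_def supp_def)
next
  case False
  then show ?thesis by (auto simp: twin_stalactic_def)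
qed

text \<open>All twins share the content of \<open>TL\<close>, so the label word determines them; the
  inverse map is \<open>tableau_of (cont TL)\<close>.\<close>

lemma bij_betw_twin_stalactic:
  assumes "stalactic TL"
  shows "bij_betw (map col_label) {TR. twin_stalactic TL TR}
           (rearrangements (\<lambda>c. cont TL c = 1) (map col_label TL))"
  unfolding bij_betw_def
proof
  show "inj_on (map col_label) {TR. twin_stalactic TL TR}"
    by (rule inj_onI) (metis mem_Collect_eq tableau_of_cont twin_stalactic_def)
  show "map col_label ` {TR. twin_stalactic TL TR} =
      rearrangements (\<lambda>c. cont TL c = 1) (map col_label TL)"
  proof (intro subset_antisym subsetI)
    fix ys assume ys: "ys \<in> rearrangements (\<lambda>c. cont TL c = 1) (map col_label TL)"
    let ?T = "tableau_of (cont TL) ys"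
    have ys_props: "distinct ys" "set ys = supp TL"
      using ys by (auto simp: rearrangements_def supp_def)
    then have pos: "\<forall>c\<in>set ys. 0 < cont TL c \<and> 1 \<le> c"
      using cont_pos_iff[OF assms] supp_pos[OF assms] by blast
    then have labels: "map col_label ?T = ys" by (simp add: map_col_label_tableau_of)
    \<comment> \<open>Outside \<open>set ys\<close>, which is the support of \<open>TL\<close>, both
      contents vanish.\<close>
    have "cont TL = cont ?T"
      using cont_pos_iff[OF assms] ys_props by (auto simp: cont_tableau_of fun_eq_iff)
    then have "twin_stalactic TL ?T"
      using ys labels stalactic_tableau_of[OF ys_props(1) pos]
      by (simp add: twin_stalactic_iff[OF assms])
    with labels show "ys \<in> map col_label ` {TR. twin_stalactic TL TR}" by (metis imageI mem_Collect_eq)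
  qed (use twin_stalactic_iff[OF assms] in auto)
qed

theorem proposition5p10:
  fixes TL :: tableau and a :: "nat list" and k :: nat and m :: "nat \<Rightarrow> nat"
  assumes "stalactic TL"
    and "a = simple_labels TL" and "k = length a"
    and "\<And>i. i < k \<Longrightarrow> m i = cols_from TL (a ! i)"
  shows "finite {TR. twin_stalactic TL TR} \<and>
         real (card {TR. twin_stalactic TL TR}) = fact (card (supp TL)) / (\<Prod>i<k. real (m i))"
proof
  let ?xs = "map col_label TL" and ?S = "\<lambda>c. cont TL c = 1"
  let ?m = "\<lambda>c. length (dropWhile (\<lambda>y. y \<noteq> c) ?xs)"
  have bij: "bij_betw (map col_label) {TR. twin_stalactic TL TR} (rearrangements ?S ?xs)"
    by (rule bij_betw_twin_stalactic[OF assms(1)])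
  show "finite {TR. twin_stalactic TL TR}"
    using bij_betw_finite[OF bij] finite_rearrangements by blast
  have dist: "distinct ?xs" using assms(1) by (simp add: stalactic_iff_distinct_labels)
  have a: "a = filter ?S ?xs" using assms(1,2) simple_labels_conv_filter by simp
  have "(\<Prod>i<k. m i) = (\<Prod>i<k. ?m (a ! i))"
  proof (rule prod.cong)
    fix i assume "i \<in> {..<k}"
    then have i: "i < k" by simp
    then have "a ! i \<in> set a" using assms(3) by simp
    then have "a ! i \<in> supp TL" by (auto simp: a supp_def)
    with assms(1,4) i show "m i = ?m (a ! i)" by (simp add: cols_from_conv_dropWhile)
  qed simp
  also have "\<dots> = prod_list (map ?m a)"
    by (simp add: prod.list_conv_set_nth assms(3) atLeast0LessThan)
  finally have "card {TR. twin_stalactic TL TR} * (\<Prod>i<k. m i) = fact (length ?xs)"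
    using card_rearrangements[OF dist, of ?S] bij_betw_same_card[OF bij] a by simp
  moreover have "length ?xs = card (supp TL)"
    using distinct_card[OF dist] by (simp add: supp_conv_set)
  ultimately have "card {TR. twin_stalactic TL TR} * (\<Prod>i<k. m i) = fact (card (supp TL))"
    by simp
  then have eq: "real (card {TR. twin_stalactic TL TR}) * (\<Prod>i<k. real (m i)) = fact (card (supp TL))"
    by (metis of_nat_fact of_nat_mult of_nat_prod)
  \<comment> \<open>The product divides a nonzero factorial by \<open>eq\<close>, so the division is
    legitimate.\<close>
  moreover have "(\<Prod>i<k. real (m i)) \<noteq> 0"
    using eq fact_nonzero by fastforce
  ultimately show "real (card {TR. twin_stalactic TL TR}) =
      fact (card (supp TL)) / (\<Prod>i<k. real (m i))"
    by (simp add: field_simps)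
qed

end
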